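(* Let $G$ be a cyclic group of order $p_1p_2$, where $p_1,p_2$ are distinct primes. Then $OD(G)$ is isomorphic to the sequential join $(G_1\diamond G_2\diamond G_3)\diamond K_1$, where $G_1\cong (p_1-1)K_1$, $G_2\cong (p_1-1)(p_2-1)K_1$ and $G_3\cong (p_2-1)K_1$.
   Context: For a finite group $G$, the order divisor graph $OD(G)$ is the simple undirected graph with vertex set $G$ in which two distinct vertices $a,b$ are adjacent if and only if $o(a)\neq o(b)$ and either $o(a)\mid o(b)$ or $o(b)\mid o(a)$. $mK_1$ denotes the edgeless graph on $m$ vertices. For graphs $H_1,\dots,H_k$ on disjoint vertex sets, the sequential join $H_1\diamond H_2\diamond\cdots\diamond H_k$ is the graph on the union of their vertex sets, containing all edges of each $H_i$, together with all edges joining each vertex of $H_i$ to each vertex of $H_{i+1}$ for $1\leq i\leq k-1$ (and no other edges). Thus $(G_1\diamond G_2\diamond G_3)\diamond K_1$ is obtained from $G_1\diamond G_2\diamond G_3$ by adding one new vertex adjacent to all of its vertices. *)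

theory Defs
  imports
    "HOL-Algebra.Elementary_Groups"
    "HOL-Algebra.Multiplicative_Group"
    "HOL-Computational_Algebra.Primes"
    "Graph_Theory.Graph_Theory"
begin

text \<open>
  Simple undirected graphs are represented as in the Graph\_Theory library: a graph is a
  vertex set together with a symmetric, irreflexive set of arcs, so that an undirected
  edge \<open>ab\<close> is the pair of arcs \<open>(a, b)\<close> and \<open>(b, a)\<close>.
\<close>

text \<open>
  The intended use is for finite groups; on elements of infinite order the library sets
  \<open>ord\<close> to \<open>0\<close>.
\<close>
definition order_divisor_graph :: "('a, 'm) monoid_scheme \<Rightarrow> 'a pair_pre_digraph" where
  "order_divisor_graph G =
     \<lparr> pverts = carrier G,
       parcs = {(a, b). a \<in> carrier G \<and> b \<in> carrier G \<and> a \<noteq> b \<and>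
                  group.ord G a \<noteq> group.ord G b \<and>
                  (group.ord G a dvd group.ord G b \<or> group.ord G b dvd group.ord G a)} \<rparr>"

definition edgeless_graph :: "nat \<Rightarrow> nat pair_pre_digraph" where
  "edgeless_graph m = \<lparr> pverts = {..<m}, parcs = {} \<rparr>"

text \<open>
  The sequential join is only meant for lists of graphs with pairwise disjoint vertex sets;
  disjointness is a hypothesis wherever it is used.
\<close>
definition sequential_join :: "'a pair_pre_digraph list \<Rightarrow> 'a pair_pre_digraph" where
  "sequential_join Hs =
     \<lparr> pverts = (\<Union>H \<in> set Hs. pverts H),
       parcs = (\<Union>H \<in> set Hs. parcs H) \<union>
               (\<Union>i \<in> {i. Suc i < length Hs}.
                  pverts (Hs ! i) \<times> pverts (Hs ! Suc i) \<union>
                  pverts (Hs ! Suc i) \<times> pverts (Hs ! i)) \<rparr>"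

definition vertex_disjoint :: "'a pair_pre_digraph list \<Rightarrow> bool" where
  "vertex_disjoint Hs \<longleftrightarrow>
     (\<forall>i < length Hs. \<forall>j < length Hs. i \<noteq> j \<longrightarrow> pverts (Hs ! i) \<inter> pverts (Hs ! j) = {})"

lemma pair_graph_order_divisor_graph:
  assumes "finite (carrier G)"
  shows "pair_graph (order_divisor_graph G)"
proof -
  have "parcs (order_divisor_graph G) \<subseteq> carrier G \<times> carrier G"
    by (auto simp: order_divisor_graph_def)
  then have "finite (parcs (order_divisor_graph G))"
    using assms by (meson finite_SigmaI finite_subset)
  then show ?thesis
    using assms
    by unfold_locales (auto simp: order_divisor_graph_def symmetric_def intro!: symI)
qed

lemma pair_graph_edgeless_graph: "pair_graph (edgeless_graph m)"
  by unfold_locales (auto simp: edgeless_graph_def symmetric_def intro!: symI)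

lemma pair_graph_sequential_join:
  assumes "\<And>H. H \<in> set Hs \<Longrightarrow> pair_graph H" and disj: "vertex_disjoint Hs"
  shows "pair_graph (sequential_join Hs)"
proof -
  have wf: "fst e \<in> pverts H" "snd e \<in> pverts H" "fst e \<noteq> snd e" "(snd e, fst e) \<in> parcs H"
    if "H \<in> set Hs" "e \<in> parcs H" for H e
  proof -
    interpret H: pair_graph H by (rule assms(1)[OF that(1)])
    show "fst e \<in> pverts H" "snd e \<in> pverts H" "fst e \<noteq> snd e"
      using that H.arc_fst_in_verts H.arc_snd_in_verts H.pair_no_loops by blast+
    show "(snd e, fst e) \<in> parcs H"
      using that H.pair_sym_arcs by (cases e) (auto simp: symmetric_def elim: symE)
  qed
  have fin: "finite (pverts H)" "finite (parcs H)" if "H \<in> set Hs" for H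
    using assms(1)[OF that]
    by (auto simp: pair_graph_def pair_digraph_def pair_fin_digraph_def pair_fin_digraph_axioms_def)
  have "{i. Suc i < length Hs} \<subseteq> {..<length Hs}" by auto
  then have "finite {i. Suc i < length Hs}" by (rule finite_subset) simp
  then have F: "finite (parcs (sequential_join Hs))"
    by (auto simp: sequential_join_def intro!: fin finite_cartesian_product)
  have nth: "Hs ! i \<in> set Hs" "Hs ! Suc i \<in> set Hs" if "Suc i < length Hs" for i
    using that by auto
  have ne: "pverts (Hs ! i) \<inter> pverts (Hs ! Suc i) = {}" if "Suc i < length Hs" for i
    using disj that by (auto simp: vertex_disjoint_def)
  show ?thesis
  proof
    fix e assume "e \<in> parcs (sequential_join Hs)"
    then consider (inner) H where "H \<in> set Hs" "e \<in> parcs H"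
      | (cross) i where "Suc i < length Hs"
          "e \<in> pverts (Hs ! i) \<times> pverts (Hs ! Suc i) \<union> pverts (Hs ! Suc i) \<times> pverts (Hs ! i)"
      by (auto simp: sequential_join_def)
    then have "fst e \<in> pverts (sequential_join Hs) \<and> snd e \<in> pverts (sequential_join Hs) \<and>
        fst e \<noteq> snd e"
    proof cases
      case inner
      then show ?thesis using wf(1-3)[OF inner] by (auto simp: sequential_join_def)
    next
      case cross
      then show ?thesis using nth[OF cross(1)] ne[OF cross(1)] by (auto simp: sequential_join_def)
    qed
    then show "fst e \<in> pverts (sequential_join Hs)" "snd e \<in> pverts (sequential_join Hs)"
        "fst e \<noteq> snd e"
      by auto
  next
    show "finite (pverts (sequential_join Hs))"
      by (auto simp: sequential_join_def fin)
  next
    show "finite (parcs (sequential_join Hs))" by (rule F)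
  next
    show "symmetric (with_proj (sequential_join Hs))"
      using wf(4) by (fastforce simp: symmetric_def sequential_join_def intro!: symI)
  qed
qed

lemma digraph_iso_edgeless_graph:
  "digraph_iso \<lparr> pverts = {a..<a + m}, parcs = {} \<rparr> (edgeless_graph m)"
proof -
  let ?H = "with_proj \<lparr> pverts = {a..<a + m}, parcs = {} \<rparr>"
  let ?f = "\<lparr> iso_verts = (\<lambda>x. x - a), iso_arcs = (\<lambda>e :: nat \<times> nat. e),
    iso_head = snd, iso_tail = fst \<rparr>"
  have "(\<lambda>x. x - a) ` {a..<a + m} = {..<m}"
    by (auto simp: image_iff intro!: bexI[of _ "_ + a"])
  then have "with_proj (edgeless_graph m) = app_iso ?f ?H"
    by (simp add: app_iso_def with_proj_def edgeless_graph_def)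
  moreover have "pre_digraph.digraph_isomorphism ?H ?f"
    by (auto simp: pre_digraph.digraph_isomorphism_def wf_digraph_def inj_on_def)
  ultimately show ?thesis
    unfolding digraph_iso_def by blast
qed

lemma ex_vertex_disjoint_edgeless_graphs:
  "\<exists>(G1 :: nat pair_pre_digraph) (G2 :: nat pair_pre_digraph)
      (G3 :: nat pair_pre_digraph) (K :: nat pair_pre_digraph).
     digraph_iso (with_proj G1) (edgeless_graph l) \<and> digraph_iso (with_proj G2) (edgeless_graph m) \<and>
     digraph_iso (with_proj G3) (edgeless_graph n) \<and> K\<^bsub>1\<^esub> (with_proj K) \<and>
     vertex_disjoint [G1, G2, G3, K]"
proof -
  let ?E = "\<lambda>a k :: nat. \<lparr> pverts = {a..<a + k}, parcs = {} \<rparr>"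
  have "K\<^bsub>1\<^esub> (with_proj (?E (l + m + n) 1))"
    by (auto simp: complete_digraph_pair_def)
  moreover have "vertex_disjoint [?E 0 l, ?E l m, ?E (l + m) n, ?E (l + m + n) 1]"
    by (auto simp: vertex_disjoint_def less_Suc_eq numeral_eq_Suc)
  ultimately show ?thesis
    using digraph_iso_edgeless_graph[of 0 l] digraph_iso_edgeless_graph[of l m]
      digraph_iso_edgeless_graph[of "l + m" n]
    by blast
qed

end

theory Submission
  imports Defs "HOL-Number_Theory.Totient"
begin

text \<open>
  A cyclic group of order \<open>n\<close> has exactly \<open>\<phi>(d)\<close> elements of order \<open>d\<close> for every \<open>d\<close> dividing
  \<open>n\<close>. Label the vertices of \<open>G1\<close>, \<open>G2\<close>, \<open>G3\<close>, \<open>K\<close> by \<open>p1\<close>, \<open>p1 * p2\<close>, \<open>p2\<close>, \<open>1\<close>. Both graphs then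
  have the same adjacency rule in terms of labels (distinct, and one divides the other) and the same
  number of vertices for every label, so any label-preserving bijection is an isomorphism.
\<close>

text \<open>Finite fibres of equal size over a label \<open>c\<close> admit a bijection
  \<open>F c\<close>. These glue to \<open>F (g x) x\<close>, which is injective because the label
  of the image reveals which \<open>F c\<close> was applied.\<close>

lemma ex_bij_betw_fibres:
  assumes "finite A" "finite B"
    and "\<And>c. card {x \<in> A. g x = c} = card {y \<in> B. h y = c}"
  shows "\<exists>f. bij_betw f A B \<and> (\<forall>x\<in>A. h (f x) = g x)"
proof -
  have "\<exists>F. bij_betw F {x \<in> A. g x = c} {y \<in> B. h y = c}" for c
    using assms by (intro finite_same_card_bij) auto
  then obtain F where F: "\<And>c. bij_betw (F c) {x \<in> A. g x = c} {y \<in> B. h y = c}"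
    by metis
  have im: "F (g x) x \<in> B \<and> h (F (g x) x) = g x" if "x \<in> A" for x
    using bij_betwE[OF F[of "g x"]] that by blast
  have "inj_on (\<lambda>x. F (g x) x) A"
  proof (rule inj_onI)
    fix x y assume xy: "x \<in> A" "y \<in> A" "F (g x) x = F (g y) y"
    then have "g x = g y" using im by metis
    with xy show "x = y" using bij_betw_imp_inj_on[OF F[of "g x"]] by (auto dest: inj_onD)
  qed
  moreover have "y \<in> (\<lambda>x. F (g x) x) ` A" if "y \<in> B" for y
  proof -
    have "y \<in> F (h y) ` {x \<in> A. g x = h y}"
      using bij_betw_imp_surj_on[OF F[of "h y"]] that by blast
    then show ?thesis by (auto intro: rev_image_eqI)
  qed
  ultimately have "bij_betw (\<lambda>x. F (g x) x) A B"
    using im by (auto simp: bij_betw_def)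
  with im show ?thesis by blast
qed

text \<open>Arcs here are pairs of vertices, so the vertex bijection forces the arc map
  \<open>map_prod f f\<close>. Well-formedness puts the ends of every arc in the vertex set, where
  \<open>arcs\<close> and the surjectivity of \<open>f\<close> apply.\<close>

lemma digraph_isoI_with_proj:
  assumes "pair_wf_digraph G" "pair_wf_digraph H" and f: "bij_betw f (pverts G) (pverts H)"
    and arcs: "\<And>u v. u \<in> pverts G \<Longrightarrow> v \<in> pverts G \<Longrightarrow>
      (u, v) \<in> parcs G \<longleftrightarrow> (f u, f v) \<in> parcs H"
  shows "digraph_iso (with_proj G) (with_proj H)"
proof -
  interpret G: pair_wf_digraph G by fact
  interpret H: pair_wf_digraph H by fact
  let ?f = "\<lparr> iso_verts = f, iso_arcs = map_prod f f, iso_head = snd, iso_tail = fst \<rparr>"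
  have inj: "inj_on f (pverts G)" and surj: "f ` pverts G = pverts H"
    using f by (auto simp: bij_betw_def)
  have "map_prod f f ` parcs G = parcs H"
  proof (intro equalityI subsetI)
    fix e assume "e \<in> map_prod f f ` parcs G"
    then obtain u v where uv: "e = (f u, f v)" "(u, v) \<in> parcs G" by auto
    then show "e \<in> parcs H"
      using arcs[OF G.wellformed'[OF uv(2)]] by simp
  next
    fix e assume e: "e \<in> parcs H"
    obtain u v where uv: "e = (f u, f v)" "u \<in> pverts G" "v \<in> pverts G"
    proof -
      have "fst e \<in> f ` pverts G" "snd e \<in> f ` pverts G"
        using e H.arc_fst_in_verts H.arc_snd_in_verts surj by blast+
      then show ?thesis using that by (metis imageE prod.collapse)
    qed
    then have "(u, v) \<in> parcs G" using e arcs by blast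
    then show "e \<in> map_prod f f ` parcs G"
      using uv(1) by (auto intro: rev_image_eqI)
  qed
  then have "with_proj H = app_iso ?f (with_proj G)"
    using surj by (simp add: app_iso_def with_proj_def)
  moreover have "inj_on (map_prod f f) (parcs G)"
    by (rule inj_on_subset[OF map_prod_inj_on[OF inj inj]]) (auto dest: G.wellformed')
  then have "pre_digraph.digraph_isomorphism (with_proj G) ?f"
    using inj G.wf_digraph_axioms by (auto simp: pre_digraph.digraph_isomorphism_def)
  ultimately show ?thesis unfolding digraph_iso_def by blast
qed

text \<open>Reduces the isomorphism hypotheses on \<open>G1\<close>, \<open>G2\<close>,
  \<open>G3\<close> to facts that do not mention the isomorphism: the image of the arc set is empty,
  and the vertex map is injective with image \<open>{..<m}\<close>.\<close>

lemma digraph_iso_edgeless_graphD: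
  assumes "digraph_iso (with_proj H) (with_proj (edgeless_graph m))"
  shows "parcs H = {}" and "card (pverts H) = m"
proof -
  obtain f where f: "pre_digraph.digraph_isomorphism (with_proj H) f"
    "with_proj (edgeless_graph m) = app_iso f (with_proj H)"
    using assms unfolding digraph_iso_def by blast
  then have "iso_arcs f ` parcs H = {}" and v: "iso_verts f ` pverts H = {..<m}"
    by (auto simp: app_iso_def with_proj_def edgeless_graph_def)
  then show "parcs H = {}" by simp
  have "inj_on (iso_verts f) (pverts H)"
    using f(1) by (simp add: pre_digraph.digraph_isomorphism_def)
  then show "card (pverts H) = m" using v by (metis card_image card_lessThan)
qed

lemma vertex_disjoint_Nil [simp]: "vertex_disjoint []"
  by (simp add: vertex_disjoint_def)

text \<open>Trades indices for list membership, so that simplification can unfold disjointness for a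
  concrete list.\<close>

lemma vertex_disjoint_Cons:
  "vertex_disjoint (H # Hs) \<longleftrightarrow>
     (\<forall>H' \<in> set Hs. pverts H \<inter> pverts H' = {}) \<and> vertex_disjoint Hs"
proof -
  have "vertex_disjoint (H # Hs) \<longleftrightarrow>
      (\<forall>j < length Hs. pverts H \<inter> pverts (Hs ! j) = {}) \<and> vertex_disjoint Hs"
    unfolding vertex_disjoint_def length_Cons All_less_Suc2
    by (simp add: Int_commute) meson
  then show ?thesis by (simp add: all_set_conv_all_nth)
qed

text \<open>For a generator \<open>x\<close> of order \<open>n\<close>, the powers
  \<open>x [^] k\<close> with \<open>0 < k \<le> n\<close> run through the group once, and
  \<open>x [^] k\<close> has order \<open>n div gcd k n\<close>. This order is \<open>d\<close>
  exactly when \<open>gcd k n = n div d\<close>, so counting such \<open>k\<close> gives the totient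
  of \<open>n div (n div d)\<close>, which is \<open>d\<close>.\<close>

lemma (in group) card_ord_eq_totient:
  assumes "cyclic_group G" "finite (carrier G)" and d: "d dvd order G"
  shows "card {a \<in> carrier G. ord a = d} = totient d"
proof -
  obtain x where x: "x \<in> carrier G" "subgroup_generated G {x} = G"
    using assms(1) unfolding cyclic_group_def by blast
  define n where "n = order G"
  have ordx: "ord x = n"
    using cyclic_order_is_ord[OF x(1)] x(2) by (simp add: n_def)
  have n: "n > 0"
    using assms(2) by (simp add: n_def order_gt_0_iff_finite)
  \<comment> \<open>The exponents start at 1 and include \<open>n\<close>, the range over which
    \<open>card_gcd_eq_totient\<close> counts.\<close>
  have inj: "inj_on (\<lambda>k. x [^] k) {0<..n}"
    using ord_inj'[OF x(1)] ordx by (simp add: atLeastSucAtMost_greaterThanAtMost)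
  have "(\<lambda>k. x [^] k) ` {0<..n} = carrier G"
    using assms(2) x(1) inj by (intro card_subset_eq) (auto simp: card_image n_def order_def)
  then have "{a \<in> carrier G. ord a = d} = {a \<in> (\<lambda>k. x [^] k) ` {0<..n}. ord a = d}"
    by simp
  also have "\<dots> = (\<lambda>k. x [^] k) ` {k \<in> {0<..n}. ord (x [^] k) = d}"
    by blast
  finally have "{a \<in> carrier G. ord a = d} = (\<lambda>k. x [^] k) ` {k \<in> {0<..n}. ord (x [^] k) = d}" .
  then have "card {a \<in> carrier G. ord a = d} = card {k \<in> {0<..n}. ord (x [^] k) = d}"
    by (simp add: card_image inj_on_subset[OF inj]subset_iff)
  also have "{k \<in> {0<..n}. ord (x [^] k) = d} = {k \<in> {0<..n}. gcd k n = n div d}"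
  proof -
    \<comment> \<open>Both divisions are exact: the two quotients \<open>e\<close> and
      \<open>c\<close> satisfy \<open>gcd k n * e = c * d\<close>, and positive factors
      cancel.\<close>
    have "n div gcd k n = d \<longleftrightarrow> gcd k n = n div d" for k
    proof -
      obtain e c where e: "n = gcd k n * e" and c: "n = d * c"
        using d gcd_dvd2[of k n] unfolding n_def[symmetric] by (elim dvdE)
      have pos: "gcd k n > 0" "d > 0" using n c by (auto intro: Nat.gr0I)
      then have "n div gcd k n = e" "n div d = c"
        using arg_cong[OF e, of "\<lambda>m. m div gcd k n"] arg_cong[OF c, of "\<lambda>m. m div d"] by auto
      moreover have "gcd k n * e = c * d"
        using e c by (simp add: mult.commute)
      then have "e = d \<longleftrightarrow> gcd k n = c"
        using pos by auto
      ultimately show ?thesis by simp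
    qed
    then show ?thesis
      by (auto simp: ord_pow_gen[OF x(1)] ordx gcd.commute)
  qed
  also have "card \<dots> = totient (n div (n div d))"
    using d n by (intro card_gcd_eq_totient) (auto simp: n_def)
  also have "n div (n div d) = d"
    using d n by (simp add: n_def div_div_eq_right)
  finally show ?thesis .
qed

theorem theorem4:
  fixes G :: "('a, 'm) monoid_scheme" and p1 p2 :: nat
    and G1 G2 G3 K :: "'b pair_pre_digraph"
  assumes "group G" and "cyclic_group G"
    and "prime p1" and "prime p2" and "p1 \<noteq> p2" and "order G = p1 * p2"
    and "pair_graph G1" and "digraph_iso (with_proj G1) (with_proj (edgeless_graph (p1 - 1)))"
    and "pair_graph G2" and "digraph_iso (with_proj G2) (with_proj (edgeless_graph ((p1 - 1) * (p2 - 1))))"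
    and "pair_graph G3" and "digraph_iso (with_proj G3) (with_proj (edgeless_graph (p2 - 1)))"
    and "K\<^bsub>1\<^esub> (with_proj K)"
    and "vertex_disjoint [G1, G2, G3, K]"
  shows "digraph_iso (with_proj (order_divisor_graph G))
           (with_proj (sequential_join [sequential_join [G1, G2, G3], K]))"
proof -
  interpret group G by fact
  let ?S = "sequential_join [G1, G2, G3]"
  let ?J = "sequential_join [?S, K]"
  note E1 = digraph_iso_edgeless_graphD[OF assms(8)]
  note E2 = digraph_iso_edgeless_graphD[OF assms(10)]
  note E3 = digraph_iso_edgeless_graphD[OF assms(12)]
  have K: "finite (pverts K)" "card (pverts K) = 1" "parcs K = {}"
    using assms(13) unfolding complete_digraph_pair_def
    by (auto simp: card_1_singleton_iff)
  have p: "p1 > 1" "p2 > 1" "coprime p1 p2" "\<not> p1 dvd p2" "\<not> p2 dvd p1"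
    using assms(3-5) prime_gt_1_nat primes_coprime primes_dvd_imp_eq by blast+
  have fin: "finite (carrier G)"
    using p assms(6) by (simp flip: order_gt_0_iff_finite)
  have dvd: "d dvd p1 * p2 \<longleftrightarrow> d \<in> {1, p1, p2, p1 * p2}" for d
  proof
    assume "d dvd p1 * p2"
    then obtain b c where d: "d = b * c" "b dvd p1" "c dvd p2"
      using division_decomp by blast
    then have "b = 1 \<or> b = p1" "c = 1 \<or> c = p2"
      using assms(3,4) unfolding prime_nat_iff by blast+
    with d(1) show "d \<in> {1, p1, p2, p1 * p2}"
      by auto
  qed auto
  have disj: "pverts G1 \<inter> pverts G2 = {}" "pverts G1 \<inter> pverts G3 = {}" "pverts G1 \<inter> pverts K = {}"
    "pverts G2 \<inter> pverts G3 = {}" "pverts G2 \<inter> pverts K = {}" "pverts G3 \<inter> pverts K = {}"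
    using assms(14) by (simp_all add: vertex_disjoint_Cons)
  \<comment> \<open>\<open>h\<close> is the labelling by intended element orders. The default 1 is
    the label of \<open>K\<close>, the only vertices of \<open>?J\<close> outside the other three
    graphs.\<close>
  define h where "h v = (if v \<in> pverts G1 then p1 else if v \<in> pverts G2 then p1 * p2
    else if v \<in> pverts G3 then p2 else 1)" for v
  have V: "pverts ?J = pverts G1 \<union> pverts G2 \<union> pverts G3 \<union> pverts K"
    by (auto simp: sequential_join_def)
  have h: "\<And>v. v \<in> pverts G1 \<Longrightarrow> h v = p1" "\<And>v. v \<in> pverts G2 \<Longrightarrow> h v = p1 * p2"
    "\<And>v. v \<in> pverts G3 \<Longrightarrow> h v = p2" "\<And>v. v \<in> pverts K \<Longrightarrow> h v = 1"
    using disj unfolding h_def by auto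
  have ne: "p1 \<noteq> p1 * p2" "p1 \<noteq> p2" "p1 \<noteq> 1" "p1 * p2 \<noteq> p2" "p1 * p2 \<noteq> 1" "p2 \<noteq> 1"
    using p assms(5) by auto
  \<comment> \<open>Disjoint vertex sets and four distinct labels make label and block determine
    each other. Fibres and arcs can then be described by labels alone.\<close>
  have mem: "(w \<in> pverts G1 \<longleftrightarrow> h w = p1) \<and> (w \<in> pverts G2 \<longleftrightarrow> h w = p1 * p2) \<and>
      (w \<in> pverts G3 \<longleftrightarrow> h w = p2) \<and> (w \<in> pverts K \<longleftrightarrow> h w = 1)"
    if "w \<in> pverts ?J" for w
  proof -
    from that consider "w \<in> pverts G1" | "w \<in> pverts G2" | "w \<in> pverts G3" | "w \<in> pverts K"
      unfolding V by blast
    then show ?thesis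
    proof cases
      case 1
      then have "w \<notin> pverts G2" "w \<notin> pverts G3" "w \<notin> pverts K" using disj by blast+
      with 1 h(1)[OF 1] ne show ?thesis by simp
    next
      case 2
      then have "w \<notin> pverts G1" "w \<notin> pverts G3" "w \<notin> pverts K" using disj by blast+
      with 2 h(2)[OF 2] ne show ?thesis by simp
    next
      case 3
      then have "w \<notin> pverts G1" "w \<notin> pverts G2" "w \<notin> pverts K" using disj by blast+
      with 3 h(3)[OF 3] ne show ?thesis by simp
    next
      case 4
      then have "w \<notin> pverts G1" "w \<notin> pverts G2" "w \<notin> pverts G3" using disj by blast+
      with 4 h(4)[OF 4] ne show ?thesis by simp
    qed
  qed
  \<comment> \<open>Each fibre of \<open>h\<close> is one block, whose size will be matched with a
    totient.\<close>
  have fibre: "{v \<in> pverts ?J. h v = p1} = pverts G1" "{v \<in> pverts ?J. h v = p1 * p2} = pverts G2"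
    "{v \<in> pverts ?J. h v = p2} = pverts G3" "{v \<in> pverts ?J. h v = 1} = pverts K"
    using mem V by blast+
  have card_eq: "card {a \<in> carrier G. ord a = d} = card {v \<in> pverts ?J. h v = d}" for d
  proof (cases "d dvd p1 * p2")
    case True
    then have "card {a \<in> carrier G. ord a = d} = totient d"
      using card_ord_eq_totient assms(2,6) fin by simp
    moreover have tot: "totient p1 = p1 - 1" "totient p2 = p2 - 1"
        "totient (p1 * p2) = (p1 - 1) * (p2 - 1)" "totient 1 = 1"
      using assms(3,4) p(3) by (simp_all add: totient_prime totient_mult_coprime)
    have "d \<in> {1, p1, p2, p1 * p2}" using True dvd by blast
    then have "card {v \<in> pverts ?J. h v = d} = totient d"
      by (elim insertE emptyE) (simp_all only: fibre tot E1(2) E2(2) E3(2) K(2))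
    ultimately show ?thesis by (simp only:)
  next
    \<comment> \<open>The gluing lemma needs equal fibres over every number, so non-divisors of the
      group order count too. Both fibres are empty: element orders divide the group order, and so do
      all labels.\<close>
    case False
    then have "{a \<in> carrier G. ord a = d} = {}"
      using ord_dvd_group_order assms(6) by auto
    moreover have "{v \<in> pverts ?J. h v = d} = {}"
      using False unfolding V by (auto simp: h)
    ultimately show ?thesis by (simp only: card.empty)
  qed
  have pgS: "pair_graph ?S"
    using assms(7,9,11) disj
    by (intro pair_graph_sequential_join) (auto simp: vertex_disjoint_Cons)
  have pgJ: "pair_graph ?J"
    using pgS pair_graphI_complete[OF assms(13)] disj
    by (intro pair_graph_sequential_join)
      (auto simp: vertex_disjoint_Cons sequential_join_def)
  have finJ: "finite (pverts ?J)"
    using pgJ by (simp add: pair_graph_def pair_digraph_def pair_fin_digraph_def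
        pair_fin_digraph_axioms_def)
  have I3: "{i. Suc i < length [G1, G2, G3]} = {0, 1}" and I2: "{i. Suc i < length [?S, K]} = {0}"
    by auto
  have "parcs ?S = pverts G1 \<times> pverts G2 \<union> pverts G2 \<times> pverts G1 \<union>
      pverts G2 \<times> pverts G3 \<union> pverts G3 \<times> pverts G2"
    unfolding sequential_join_def I3 using E1 E2 E3 by auto
  moreover have "parcs ?J = parcs ?S \<union> pverts ?S \<times> pverts K \<union> pverts K \<times> pverts ?S"
    unfolding sequential_join_def[of "[?S, K]"] I2 using K by auto
  moreover have "pverts ?S = pverts G1 \<union> pverts G2 \<union> pverts G3"
    by (auto simp: sequential_join_def)
  \<comment> \<open>\<open>K\<close> is joined to \<open>?S\<close> as a single block, hence to all
    three graphs, while \<open>G1\<close> and \<open>G3\<close> remain nonadjacent.\<close>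
  ultimately have arcs: "parcs ?J = pverts G1 \<times> pverts G2 \<union> pverts G2 \<times> pverts G1 \<union>
      pverts G2 \<times> pverts G3 \<union> pverts G3 \<times> pverts G2 \<union>
      (pverts G1 \<union> pverts G2 \<union> pverts G3) \<times> pverts K \<union>
      pverts K \<times> (pverts G1 \<union> pverts G2 \<union> pverts G3)"
    by simp
  have adj: "(u, v) \<in> parcs ?J \<longleftrightarrow> h u \<noteq> h v \<and> (h u dvd h v \<or> h v dvd h u)"
    if "u \<in> pverts ?J" "v \<in> pverts ?J" for u v
  proof -
    have "h w \<in> {p1, p1 * p2, p2, 1}" if "w \<in> pverts ?J" for w
      using that h unfolding V by blast
    note range = this[OF that(1)] this[OF that(2)]
    have "(u, v) \<in> parcs ?J \<longleftrightarrow> h u = p1 \<and> h v = p1 * p2 \<or> h u = p1 * p2 \<and> h v = p1 \<or>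
        h u = p1 * p2 \<and> h v = p2 \<or> h u = p2 \<and> h v = p1 * p2 \<or>
        (h u = p1 \<or> h u = p1 * p2 \<or> h u = p2) \<and> h v = 1 \<or>
        h u = 1 \<and> (h v = p1 \<or> h v = p1 * p2 \<or> h v = p2)"
      by (simp only: arcs Un_iff mem_Sigma_iff mem[OF that(1)] mem[OF that(2)] disj_assoc)
    \<comment> \<open>Sixteen label pairs remain. Among distinct labels only \<open>p1\<close> and
      \<open>p2\<close> are incomparable under divisibility, which matches the missing arcs between
      \<open>G1\<close> and \<open>G3\<close>.\<close>
    with range show ?thesis
      using p(4,5) ne by (elim insertE emptyE) simp_all
  qed
  obtain f where f: "bij_betw f (carrier G) (pverts ?J)" "\<forall>a\<in>carrier G. h (f a) = ord a"
    using ex_bij_betw_fibres[OF fin finJ card_eq] by blast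
  show ?thesis
  proof (rule digraph_isoI_with_proj)
    show "pair_wf_digraph (order_divisor_graph G)"
      using pair_graph_order_divisor_graph[OF fin]
      by (simp add: pair_graph_def pair_digraph_def pair_fin_digraph_def)
    show "pair_wf_digraph ?J"
      using pgJ by (simp add: pair_graph_def pair_digraph_def pair_fin_digraph_def)
    show "bij_betw f (pverts (order_divisor_graph G)) (pverts ?J)"
      using f(1) by (simp add: order_divisor_graph_def)
    fix a b assume "a \<in> pverts (order_divisor_graph G)" "b \<in> pverts (order_divisor_graph G)"
    then have ab: "a \<in> carrier G" "b \<in> carrier G" by (simp_all add: order_divisor_graph_def)
    then have "f a \<in> pverts ?J" "f b \<in> pverts ?J" using bij_betwE[OF f(1)] by auto
    then show "(a, b) \<in> parcs (order_divisor_graph G) \<longleftrightarrow> (f a, f b) \<in> parcs ?J"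
      using ab f(2) by (auto simp: adj order_divisor_graph_def)
  qed
qed

end
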